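(* Let $n\ge 1$, let $(a,b)$ be an interval parking function for $n$ cars, and let $x=\mathcal{O}(a)$ and $y=\mathcal{O}(b^* )^*$. Then $x\geq_B y$ in Bruhat order on $\mathfrak{S}_n$.
   Context: Notation: $[m,n]=\{m,\dots,n\}$, $[n]=[1,n]$; lists and permutations are written $a=(a(1),\dots,a(n))$. For $a,b\in\mathbb{Z}^n$, $a\leq_C b$ means $a(i)\leq b(i)$ for all $i$. For $x\in[n]^n$ the conjugate is $x^*=(n+1-x(n),\dots,n+1-x(1))$. $\mathfrak{S}_n$ is the group of permutations of $[n]$. Parking functions: cars $1,\dots,n$ enter, in this order, a one-way street with spots $1,\dots,n$. Given $a\in[n]^n$ (Algorithm A), car $i$ parks in the first (lowest-numbered) available spot in $[a(i),n]$; if there is none, the algorithm fails. If all cars park, $a$ is a parking function, and its outcome is the permutation $\mathcal{O}(a)=w\in\mathfrak{S}_n$, where car $i$ parks in spot $w(i)$. Interval parking functions (IPFs): given $a,b\in[n]^n$ with $a\leq_C b$ (Algorithm B), car $i$ parks in the first available spot in $[a(i),b(i)]$; if there is none, the algorithm fails. If all cars park, $(a,b)$ is an interval parking function. If $(a,b)$ is an IPF, then both $a$ and $b^*$ are parking functions, so $\mathcal{O}(a)$ and $\mathcal{O}(b^* )$ are defined. Bruhat order $\geq_B$ on $\mathfrak{S}_n$: the partial order generated by (reflexive-transitive closure of) the relations $x>t_{ij}x$ whenever $\ell(x)>\ell(t_{ij}x)$, where $t_{ij}$ is the transposition of $i$ and $j$, products are composed right to left, and $\ell(x)$ is the number of inversions,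 i.e., of pairs $i<j$ with $x(i)>x(j)$. *)

theory Defs
  imports Main "HOL-Combinatorics.Permutations" "HOL-Library.FuncSet"
begin

text \<open>
  A list \<open>(a(1), \<dots>, a(n))\<close> is a function on \<open>nat\<close> of which only the values on
  \<open>{1..n}\<close> matter. Permutations of \<open>[n]\<close> follow the library convention
  \<open>permutes\<close>: they are the identity outside \<open>{1..n}\<close>, so that equality of functions
  is equality of permutations.
\<close>

definition conjugate :: "nat \<Rightarrow> (nat \<Rightarrow> nat) \<Rightarrow> nat \<Rightarrow> nat" where
  "conjugate n x = (\<lambda>i. if i \<in> {1..n} then n + 1 - x (n + 1 - i) else i)"

definition first_available :: "nat set \<Rightarrow> nat \<Rightarrow> nat \<Rightarrow> nat option" where
  "first_available occupied l u =
     (if {l..u} - occupied = {} then None else Some (Min ({l..u} - occupied)))"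

text \<open>
  \<open>park a b k\<close> lets the cars \<open>1, \<dots>, k\<close> enter in this order, car \<open>i\<close> taking the first
  available spot in \<open>[a(i), b(i)]\<close>. It is \<open>None\<close> if some car fails to park, and otherwise
  \<open>Some w\<close> with \<open>w i\<close> the spot of car \<open>i\<close> for \<open>i \<in> {1..k}\<close> and \<open>w i = i\<close> elsewhere.
\<close>

primrec park :: "(nat \<Rightarrow> nat) \<Rightarrow> (nat \<Rightarrow> nat) \<Rightarrow> nat \<Rightarrow> (nat \<Rightarrow> nat) option" where
  "park a b 0 = Some id"
| "park a b (Suc k) =
     (case park a b k of
        None \<Rightarrow> None
      | Some w \<Rightarrow>
          (case first_available (w ` {1..k}) (a (Suc k)) (b (Suc k)) of
             None \<Rightarrow> None
           | Some s \<Rightarrow> Some (w(Suc k := s))))"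

definition parking_function :: "nat \<Rightarrow> (nat \<Rightarrow> nat) \<Rightarrow> bool" where
  "parking_function n a \<longleftrightarrow> a \<in> {1..n} \<rightarrow> {1..n} \<and> park a (\<lambda>_. n) n \<noteq> None"

text \<open>Only meaningful if \<open>parking_function n a\<close>; otherwise the value is unspecified.\<close>

definition outcome :: "nat \<Rightarrow> (nat \<Rightarrow> nat) \<Rightarrow> nat \<Rightarrow> nat" where
  "outcome n a = the (park a (\<lambda>_. n) n)"

definition interval_parking_function :: "nat \<Rightarrow> (nat \<Rightarrow> nat) \<Rightarrow> (nat \<Rightarrow> nat) \<Rightarrow> bool" where
  "interval_parking_function n a b \<longleftrightarrow>
     a \<in> {1..n} \<rightarrow> {1..n} \<and> b \<in> {1..n} \<rightarrow> {1..n} \<and>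
     (\<forall>i\<in>{1..n}. a i \<le> b i) \<and> park a b n \<noteq> None"

definition num_inversions :: "nat \<Rightarrow> (nat \<Rightarrow> nat) \<Rightarrow> nat" where
  "num_inversions n x =
     card {(i, j). i \<in> {1..n} \<and> j \<in> {1..n} \<and> i < j \<and> x i > x j}"

text \<open>Left multiplication by \<open>t\<^sub>i\<^sub>j\<close> exchanges the values \<open>i\<close> and \<open>j\<close> of \<open>x\<close>.\<close>

definition bruhat_down :: "nat \<Rightarrow> (nat \<Rightarrow> nat) \<Rightarrow> (nat \<Rightarrow> nat) \<Rightarrow> bool" where
  "bruhat_down n x y \<longleftrightarrow>
     (\<exists>i\<in>{1..n}. \<exists>j\<in>{1..n}. i \<noteq> j \<and> y = transpose i j \<circ> x \<and>
        num_inversions n x > num_inversions n y)"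

definition bruhat_ge :: "nat \<Rightarrow> (nat \<Rightarrow> nat) \<Rightarrow> (nat \<Rightarrow> nat) \<Rightarrow> bool" where
  "bruhat_ge n x y \<longleftrightarrow>
     x permutes {1..n} \<and> y permutes {1..n} \<and> (bruhat_down n)\<^sup>*\<^sup>* x y"

end

theory Submission
  imports Defs
begin

text \<open>
  The spots of an interval parking function \<open>(a, b)\<close> are those that the cars get from \<open>a\<close>
  alone, because a car that finds a spot in \<open>[a(i), b(i)]\<close> finds the same one in \<open>[a(i), n]\<close>.
  Hence \<open>x\<close> is the permutation computed by Algorithm B, which gives
  \<open>x \<le>\<^sub>C b\<close> (lemma \<open>outcome_interval_parking_function\<close>).

  Conjugation reverses the street and the order of the cars, so \<open>x \<le>\<^sub>C b\<close> becomes
  \<open>b\<^sup>* \<le>\<^sub>C x\<^sup>*\<close>. Lemma \<open>bruhat_ge_outcome_if_dominates\<close> says that if a preference list \<open>c\<close>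
  lies below a permutation \<open>u\<close>, then \<open>u \<ge>\<^sub>B \<O>(c)\<close>. In other words, \<open>\<O>(c)\<close>, which lies above
  \<open>c\<close> itself, is the Bruhat minimum of the permutations above \<open>c\<close>. The reason is an exchange
  argument. Suppose that \<open>u\<close> agrees with the parking process up to car \<open>k\<close>, and that car
  \<open>k + 1\<close> takes the spot \<open>s\<close>. The spot \<open>u(k + 1)\<close> is still available and is at least
  \<open>c(k + 1)\<close>, so \<open>s \<le> u(k + 1)\<close>. If the two differ, \<open>u\<close> gives \<open>s\<close> to a later car, and exchanging
  the two spots removes an inversion, keeps \<open>u\<close> above \<open>c\<close>, and makes it agree with the process
  up to car \<open>k + 1\<close>.

  With \<open>c = b\<^sup>*\<close> and \<open>u = x\<^sup>*\<close> this gives \<open>x\<^sup>* \<ge>\<^sub>B \<O>(b\<^sup>*)\<close>. Conjugation preserves the Bruhat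
  order (lemma \<open>bruhat_ge_conjugate\<close>) and is an involution, so \<open>x \<ge>\<^sub>B \<O>(b\<^sup>*)\<^sup>* = y\<close>.
\<close>

section \<open>The parking process\<close>

lemma first_available_eq_Some_iff:
  "first_available occupied l u = Some s \<longleftrightarrow>
     s \<in> {l..u} - occupied \<and> (\<forall>t\<in>{l..u} - occupied. s \<le> t)"
  unfolding first_available_def
  by (auto simp: Min_eq_iff intro: Min_eqI[symmetric])

lemma park_SomeD:
  assumes "park a b k = Some w"
  shows "inj_on w {1..k}" "\<And>i. i \<in> {1..k} \<Longrightarrow> a i \<le> w i \<and> w i \<le> b i"
    "\<And>i. i \<notin> {1..k} \<Longrightarrow> w i = i"
proof -
  have "inj_on w {1..k} \<and> (\<forall>i\<in>{1..k}. a i \<le> w i \<and> w i \<le> b i) \<and> (\<forall>i. i \<notin> {1..k} \<longrightarrow> w i = i)"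
    using assms
  proof (induction k arbitrary: w)
    case 0
    then show ?case by simp
  next
    case (Suc k)
    from Suc.prems obtain v s where v: "park a b k = Some v"
      and s: "first_available (v ` {1..k}) (a (Suc k)) (b (Suc k)) = Some s"
      and w: "w = v(Suc k := s)"
      by (auto split: option.splits)
    have s': "a (Suc k) \<le> s" "s \<le> b (Suc k)" "s \<notin> v ` {1..k}"
      using s by (auto simp: first_available_eq_Some_iff)
    note IH = Suc.IH[OF v]
    have wv: "w i = v i" if "i \<in> {1..k}" for i
      using that by (simp add: w)
    have "inj_on w {1..k}"
      using IH inj_on_cong[of "{1..k}" w v, OF wv] by blast
    moreover have "w ` {1..k} = v ` {1..k}"
      using wv by (rule image_cong[OF refl])
    ultimately have "inj_on w {1..Suc k}"
      using s' by (auto simp: atLeastAtMostSuc_conv w)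
    moreover have "\<forall>i\<in>{1..Suc k}. a i \<le> w i \<and> w i \<le> b i"
      using IH s' by (auto simp: w atLeastAtMostSuc_conv)
    moreover have "\<forall>i. i \<notin> {1..Suc k} \<longrightarrow> w i = i"
      using IH by (auto simp: w)
    ultimately show ?case by blast
  qed
  then show "inj_on w {1..k}" "\<And>i. i \<in> {1..k} \<Longrightarrow> a i \<le> w i \<and> w i \<le> b i"
    "\<And>i. i \<notin> {1..k} \<Longrightarrow> w i = i"
    by blast+
qed

text \<open>Enlarging an interval to the right does not change its least available element.\<close>

lemma park_extend_intervals:
  assumes "park a b k = Some w" and "\<And>i. i \<in> {1..k} \<Longrightarrow> b i \<le> b' i"
  shows "park a b' k = Some w"
  using assms
proof (induction k arbitrary: w)
  case 0
  then show ?case by (simp only: park.simps)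
next
  case (Suc k)
  from Suc.prems(1) obtain v s where v: "park a b k = Some v"
    and s: "first_available (v ` {1..k}) (a (Suc k)) (b (Suc k)) = Some s"
    and w: "w = v(Suc k := s)"
    by (auto split: option.splits)
  have "park a b' k = Some v"
    using Suc.IH[OF v] Suc.prems(2) by simp
  moreover have "first_available (v ` {1..k}) (a (Suc k)) (b' (Suc k)) = Some s"
    using s Suc.prems(2)[of "Suc k"] unfolding first_available_eq_Some_iff
    by fastforce
  ultimately show ?case unfolding w by (simp add: fun_upd_def)
qed

lemma outcome_interval_parking_function:
  assumes "interval_parking_function n a b"
  shows "outcome n a permutes {1..n}"
    and "\<And>i. i \<in> {1..n} \<Longrightarrow> outcome n a i \<le> b i"
proof -
  from assms obtain w where w: "park a b n = Some w"
    and a: "a \<in> {1..n} \<rightarrow> {1..n}" and b: "b \<in> {1..n} \<rightarrow> {1..n}"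
    by (auto simp: interval_parking_function_def)
  have "park a (\<lambda>_. n) n = Some w"
    using park_extend_intervals[OF w, of "\<lambda>_. n"] b by fastforce
  then have out: "outcome n a = w"
    by (simp add: outcome_def)
  note D = park_SomeD[OF w]
  have "w ` {1..n} \<subseteq> {1..n}"
  proof
    fix s assume "s \<in> w ` {1..n}"
    then obtain i where i: "i \<in> {1..n}" "s = w i" by blast
    have "a i \<in> {1..n}" "b i \<in> {1..n}" using a b i by blast+
    with D(2)[OF i(1)] i show "s \<in> {1..n}" by simp
  qed
  then have "bij_betw w {1..n} {1..n}"
    using D(1) by (simp add: bij_betw_def endo_inj_surj)
  then show "outcome n a permutes {1..n}"
    unfolding out using D(3) by (rule bij_imp_permutes)
  show "outcome n a i \<le> b i" if "i \<in> {1..n}" for i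
    using D(2)[OF that] out by simp
qed

section \<open>Exchanging the values of an inversion\<close>

text \<open>
  Let \<open>\<tau>\<close> exchange the positions \<open>p\<close> and \<open>q\<close>. An inversion \<open>(i, j)\<close> of \<open>x \<circ> \<tau>\<close> is sent to the
  inversion \<open>(\<tau> i, \<tau> j)\<close> of \<open>x\<close> if this pair is still in increasing order, and to itself
  otherwise. In the second case one of the positions is \<open>p\<close> or \<open>q\<close> and the other lies between
  them, and \<open>x p > x q\<close> makes \<open>(i, j)\<close> an inversion of \<open>x\<close>. This map is injective and misses
  the inversion \<open>(p, q)\<close>.
\<close>

lemma num_inversions_exchange_less:
  assumes pq: "p \<in> {1..n}" "q \<in> {1..n}" "p < q" and inv: "x p > x q"
  shows "num_inversions n (x \<circ> transpose p q) < num_inversions n x"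
proof -
  define \<tau> where "\<tau> = transpose p q"
  define I where "I z = {(i, j). i \<in> {1..n} \<and> j \<in> {1..n} \<and> i < j \<and> z i > z j}"
    for z :: "nat \<Rightarrow> nat"
  define f where "f = (\<lambda>(i, j). if \<tau> i < \<tau> j then (\<tau> i, \<tau> j) else (i, j))"
  have fin: "finite (I x)"
    by (rule finite_subset[of _ "{1..n} \<times> {1..n}"]) (auto simp: I_def)
  have \<tau>_in: "\<tau> i \<in> {1..n} \<longleftrightarrow> i \<in> {1..n}" for i
    using pq by (auto simp: \<tau>_def transpose_def)
  have \<tau>_\<tau>: "\<tau> (\<tau> i) = i" for i
    by (simp add: \<tau>_def)
  then have \<tau>_inj: "\<tau> i = \<tau> j \<longleftrightarrow> i = j" for i j
    by metis
  have inj_f: "inj_on f (I (x \<circ> \<tau>))"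
  proof (rule inj_onI)
    fix r s assume r: "r \<in> I (x \<circ> \<tau>)" and s: "s \<in> I (x \<circ> \<tau>)" and eq: "f r = f s"
    obtain i j k l where rs: "r = (i, j)" "s = (k, l)" by (cases r, cases s) auto
    show "r = s"
      using r s eq by (auto simp: rs f_def I_def \<tau>_\<tau> \<tau>_inj split: if_splits)
  qed
  have f_in: "f r \<in> I x - {(p, q)}" if "r \<in> I (x \<circ> \<tau>)" for r
  proof -
    obtain i j where r: "r = (i, j)" by (cases r) auto
    have ij: "i \<in> {1..n}" "j \<in> {1..n}" "i < j" "x (\<tau> i) > x (\<tau> j)"
      using that by (auto simp: r I_def)
    show ?thesis
    proof (cases "\<tau> i < \<tau> j")
      case True
      have "(\<tau> i, \<tau> j) \<noteq> (p, q)"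
        using ij(3) pq(3) by (auto simp: \<tau>_def transpose_def split: if_splits)
      with True ij(4) iffD2[OF \<tau>_in ij(1)] iffD2[OF \<tau>_in ij(2)] show ?thesis
        by (simp add: r f_def I_def)
    next
      case False
      from False ij(3) pq(3)
      consider "i = p" "j = q" | "i = p" "p < j" "j < q" | "j = q" "p < i" "i < q"
        by (auto simp: \<tau>_def transpose_def split: if_splits)
      then have "x i > x j" "(i, j) \<noteq> (p, q)"
        using ij(4) pq(3) inv by (cases; simp add: \<tau>_def)+
      with False ij show ?thesis
        by (auto simp: r f_def I_def)
    qed
  qed
  have "card (I (x \<circ> \<tau>)) \<le> card (I x - {(p, q)})"
    using inj_f image_subsetI[OF f_in] by (rule card_inj_on_le[OF _ _ finite_Diff[OF fin]])
  also have "\<dots> < card (I x)"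
    using fin pq inv by (intro card_Diff1_less) (auto simp: I_def)
  finally show ?thesis
    by (simp add: num_inversions_def I_def \<tau>_def)
qed

text \<open>
  Exchanging the values \<open>x p\<close> and \<open>x q\<close> on the left is exchanging the positions \<open>p\<close> and \<open>q\<close> on
  the right; the Bruhat order is defined by the former and inversions are counted with the latter.
\<close>

lemma bruhat_down_exchange:
  assumes x: "x permutes {1..n}" and pq: "p \<in> {1..n}" "q \<in> {1..n}" "p < q" and inv: "x p > x q"
  shows "bruhat_down n x (x \<circ> transpose p q)"
proof -
  have "x \<circ> transpose p q = transpose (x p) (x q) \<circ> x"
    using permutes_inj[OF x] by (auto simp: fun_eq_iff transpose_def inj_eq)
  moreover have "x p \<in> {1..n}" "x q \<in> {1..n}"
    using permutes_in_image[OF x] pq by blast+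
  moreover have "x p \<noteq> x q"
    using inv by simp
  ultimately show ?thesis
    using num_inversions_exchange_less[of p n q x] assms unfolding bruhat_down_def by blast
qed

section \<open>The outcome as a Bruhat minimum\<close>

text \<open>
  Below, \<open>z\<close> is the permutation obtained from \<open>u\<close> by the exchanges made for the first \<open>k\<close> cars.
  That the algorithm does not fail comes out of the same induction, because \<open>z\<close> always
  exhibits an available spot for the next car.
\<close>

lemma bruhat_ge_outcome_if_dominates:
  assumes c: "\<And>i. i \<in> {1..n} \<Longrightarrow> 1 \<le> c i"
    and u: "u permutes {1..n}" and dom: "\<And>i. i \<in> {1..n} \<Longrightarrow> c i \<le> u i"
  shows "bruhat_ge n u (outcome n c)"
proof -
  have "\<exists>w z. park c (\<lambda>_. n) k = Some w \<and> z permutes {1..n} \<and> (\<forall>i\<in>{1..n}. c i \<le> z i) \<and>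
          (bruhat_down n)\<^sup>*\<^sup>* u z \<and> (\<forall>i\<in>{1..k}. w i = z i)" if "k \<le> n" for k
    using that
  proof (induction k)
    case 0
    show ?case using u dom by (auto intro!: exI[of _ u])
  next
    case (Suc k)
    then obtain w z where w: "park c (\<lambda>_. n) k = Some w" and z: "z permutes {1..n}"
      and cz: "\<forall>i\<in>{1..n}. c i \<le> z i" and uz: "(bruhat_down n)\<^sup>*\<^sup>* u z"
      and wz: "\<forall>i\<in>{1..k}. w i = z i"
      by auto
    have in_range: "z i \<in> {1..n} \<longleftrightarrow> i \<in> {1..n}" for i
      using permutes_in_image[OF z] .
    have inj: "z i = z j \<longleftrightarrow> i = j" for i j
      using permutes_inj[OF z] by (simp add: inj_eq)
    have occ: "w ` {1..k} = z ` {1..k}"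
      using wz by (intro image_cong) auto
    let ?A = "{c (Suc k)..n} - w ` {1..k}"
    have k: "Suc k \<in> {1..n}"
      using Suc.prems by simp
    have z_avail: "z (Suc k) \<in> ?A"
      using cz in_range[of "Suc k"] k unfolding occ by (auto simp: inj)
    define s where "s = Min ?A"
    have s: "first_available (w ` {1..k}) (c (Suc k)) n = Some s"
      using z_avail by (auto simp: first_available_def s_def)
    have sA: "c (Suc k) \<le> s" "s \<le> n" "s \<notin> z ` {1..k}" and s_le: "s \<le> z (Suc k)"
      using s z_avail unfolding first_available_eq_Some_iff occ by auto
    have step: "park c (\<lambda>_. n) (Suc k) = Some (w(Suc k := s))"
      using w s by simp
    show ?case
    proof (cases "s = z (Suc k)")
      case True
      then have "\<forall>i\<in>{1..Suc k}. (w(Suc k := s)) i = z i"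
        using wz by (auto simp: atLeastAtMostSuc_conv)
      with step z cz uz show ?thesis by blast
    next
      case False
      have "s \<in> {1..n}"
        using sA c[OF k] by simp
      then have "s \<in> z ` {1..n}"
        by (simp only: permutes_image[OF z])
      then obtain m where m: "m \<in> {1..n}" "z m = s"
        by blast
      have "m \<noteq> Suc k" "m \<notin> {1..k}"
        using m False sA(3) by auto
      with m have "Suc k < m"
        by auto
      let ?z = "z \<circ> transpose (Suc k) m"
      have "bruhat_down n z ?z"
        using z k m(1) \<open>Suc k < m\<close> by (rule bruhat_down_exchange) (use m s_le False in simp)
      with uz have "(bruhat_down n)\<^sup>*\<^sup>* u ?z"
        by (meson rtranclp.rtrancl_into_rtrancl)
      moreover have "?z permutes {1..n}"
        using permutes_compose[OF permutes_swap_id[OF k m(1)] z] .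
      moreover have "c i \<le> ?z i" if "i \<in> {1..n}" for i
      proof -
        \<comment> \<open>Car \<open>m\<close> gets the spot \<open>z (Suc k)\<close>, which is larger than its old spot \<open>s\<close>.\<close>
        have "c m \<le> z (Suc k)"
          using cz m s_le by fastforce
        then show ?thesis
          using cz that sA(1) m by (auto simp: transpose_def)
      qed
      moreover have "\<forall>i\<in>{1..Suc k}. (w(Suc k := s)) i = ?z i"
        using wz m \<open>Suc k < m\<close> by (auto simp: transpose_def)
      ultimately show ?thesis
        using step by blast
    qed
  qed
  from this[of n] obtain w z where w: "park c (\<lambda>_. n) n = Some w" and z: "z permutes {1..n}"
    and uz: "(bruhat_down n)\<^sup>*\<^sup>* u z" and wz: "\<forall>i\<in>{1..n}. w i = z i"
    by auto
  have "w i = z i" for i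
    using wz park_SomeD(3)[OF w] permutes_not_in[OF z] by (cases "i \<in> {1..n}") auto
  then have "outcome n c = z"
    using w by (auto simp: outcome_def)
  with u z uz show "bruhat_ge n u (outcome n c)"
    by (simp add: bruhat_ge_def)
qed

section \<open>Conjugation\<close>

lemma conjugate_conjugate:
  assumes "x permutes {1..n}"
  shows "conjugate n (conjugate n x) = x"
proof
  fix i
  show "conjugate n (conjugate n x) i = x i"
  proof (cases "i \<in> {1..n}")
    case True
    then have "x i \<in> {1..n}"
      using permutes_in_image[OF assms] by blast
    with True show ?thesis
      by (auto simp: conjugate_def)
  next
    case False
    with permutes_not_in[OF assms this] show ?thesis
      by (simp only: conjugate_def if_False)
  qed
qed

lemma permutes_conjugate:
  assumes "x permutes {1..n}"
  shows "conjugate n x permutes {1..n}"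
proof -
  let ?r = "\<lambda>i. n + 1 - i"
  have r: "bij_betw ?r {1..n} {1..n}"
    by (rule bij_betw_byWitness[of _ ?r]) auto
  have "bij_betw (?r \<circ> x \<circ> ?r) {1..n} {1..n}"
    using r permutes_imp_bij[OF assms] by (intro bij_betw_trans)
  then have "bij_betw (conjugate n x) {1..n} {1..n}"
    by (rule bij_betw_cong[THEN iffD1, rotated]) (simp add: conjugate_def)
  then show ?thesis
    by (rule bij_imp_permutes) (auto simp: conjugate_def)
qed

text \<open>The inversions \<open>(i, j)\<close> of \<open>x\<close> and \<open>(n + 1 - j, n + 1 - i)\<close> of \<open>x\<^sup>*\<close> correspond.\<close>

lemma num_inversions_conjugate:
  assumes "x permutes {1..n}"
  shows "num_inversions n (conjugate n x) = num_inversions n x"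
proof -
  have x: "x i \<in> {1..n}" if "i \<in> {1..n}" for i
    using that permutes_in_image[OF assms] by blast
  let ?g = "\<lambda>(i, j). (n + 1 - j, n + 1 - i)"
  let ?I = "\<lambda>z. {(i, j). i \<in> {1..n} \<and> j \<in> {1..n} \<and> i < j \<and> z i > (z j :: nat)}"
  have "bij_betw ?g (?I (conjugate n x)) (?I x)"
  proof (rule bij_betw_byWitness[of _ ?g])
    show "?g ` ?I (conjugate n x) \<subseteq> ?I x"
      by (auto simp: conjugate_def)
    show "?g ` ?I x \<subseteq> ?I (conjugate n x)"
      using x by (fastforce simp: conjugate_def)
  qed auto
  then show ?thesis
    unfolding num_inversions_def by (rule bij_betw_same_card)
qed

lemma bruhat_down_permutes:
  assumes "bruhat_down n x y" and "x permutes {1..n}"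
  shows "y permutes {1..n}"
  using assms by (auto simp: bruhat_down_def intro: permutes_compose permutes_swap_id)

text \<open>
  Conjugation turns the exchange of the values \<open>i\<close> and \<open>j\<close> into that of the values
  \<open>n + 1 - i\<close> and \<open>n + 1 - j\<close>.
\<close>

lemma bruhat_down_conjugate:
  assumes "bruhat_down n x y" and x: "x permutes {1..n}"
  shows "bruhat_down n (conjugate n x) (conjugate n y)"
proof -
  obtain i j where ij: "i \<in> {1..n}" "j \<in> {1..n}" "i \<noteq> j" and y: "y = transpose i j \<circ> x"
    and less: "num_inversions n x > num_inversions n y"
    using assms(1) unfolding bruhat_down_def by blast
  let ?t = "transpose (n + 1 - i) (n + 1 - j)"
  have t: "n + 1 - transpose i j v = ?t (n + 1 - v)" if "v \<in> {1..n}" for v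
    using that ij by (auto simp: transpose_def)
  have "conjugate n y l = (?t \<circ> conjugate n x) l" for l
  proof (cases "l \<in> {1..n}")
    case True
    then have "x (n + 1 - l) \<in> {1..n}"
      unfolding permutes_in_image[OF x] by auto
    from t[OF this] True show ?thesis
      by (simp only: y conjugate_def o_apply if_True)
  next
    case False
    moreover have "n + 1 - i \<in> {1..n}" "n + 1 - j \<in> {1..n}"
      using ij by auto
    ultimately have "?t l = l"
      by (intro transpose_apply_other) blast+
    with False show ?thesis
      by (simp only: conjugate_def o_apply if_False)
  qed
  then have "conjugate n y = ?t \<circ> conjugate n x"
    by blast
  moreover have "n + 1 - i \<in> {1..n}" "n + 1 - j \<in> {1..n}" "n + 1 - i \<noteq> n + 1 - j"
    using ij by auto
  moreover have "num_inversions n (conjugate n x) > num_inversions n (conjugate n y)"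
    using less x bruhat_down_permutes[OF assms] by (simp add: num_inversions_conjugate)
  ultimately show ?thesis
    unfolding bruhat_down_def by blast
qed

lemma bruhat_ge_conjugate:
  assumes "bruhat_ge n x y"
  shows "bruhat_ge n (conjugate n x) (conjugate n y)"
proof -
  have x: "x permutes {1..n}" and "(bruhat_down n)\<^sup>*\<^sup>* x y"
    using assms by (simp_all add: bruhat_ge_def)
  from this(2) have "y permutes {1..n} \<and> (bruhat_down n)\<^sup>*\<^sup>* (conjugate n x) (conjugate n y)"
  proof (induction rule: rtranclp_induct)
    case base
    show ?case using x by simp
  next
    case (step y z)
    then show ?case
      by (meson bruhat_down_permutes bruhat_down_conjugate rtranclp.rtrancl_into_rtrancl)
  qed
  then show ?thesis
    using x permutes_conjugate unfolding bruhat_ge_def by blast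
qed

section \<open>The Bruhat inequality\<close>

theorem theorem4p1:
  fixes n :: nat and a b x y :: "nat \<Rightarrow> nat"
  assumes "n \<ge> 1"
    and "interval_parking_function n a b"
    and "x = outcome n a"
    and "y = conjugate n (outcome n (conjugate n b))"
  shows "bruhat_ge n x y"
proof -
  have x: "x permutes {1..n}"
    unfolding assms(3) using assms(2) by (rule outcome_interval_parking_function)
  have xb: "x i \<le> b i" if "i \<in> {1..n}" for i
    unfolding assms(3) using assms(2) that by (rule outcome_interval_parking_function)
  have b: "b i \<in> {1..n}" if "i \<in> {1..n}" for i
    using assms(2) that unfolding interval_parking_function_def by blast
  have "bruhat_ge n (conjugate n x) (outcome n (conjugate n b))"
  proof (rule bruhat_ge_outcome_if_dominates)
    fix i assume i: "i \<in> {1..n}"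
    then have i': "n + 1 - i \<in> {1..n}" by auto
    show "1 \<le> conjugate n b i"
      using b[OF i'] i by (auto simp: conjugate_def)
    show "conjugate n b i \<le> conjugate n x i"
      using xb[OF i'] i by (auto simp: conjugate_def)
  qed (rule permutes_conjugate[OF x])
  from bruhat_ge_conjugate[OF this] show ?thesis
    unfolding assms(4) conjugate_conjugate[OF x] .
qed

end
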